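(* The pair $(\mathbb{R},\mathbb{R})$ has the maximal approximation by affine property.
   Context: For real Banach spaces $X,Y$, $\mathrm{Lip}(X,Y)$ denotes the set of all Lipschitz maps $f:X\to Y$. For a map $f$ defined on a set $A\subseteq X$, its Lipschitz number is $\mathrm{Lip}(f)=\sup\{\|f(p)-f(q)\|/\|p-q\| : p,q\in A,\ p\neq q\}$. Balls have positive (finite) radius, and $\mathrm{diam}$ denotes diameter. A pair $(X,Y)$ of Banach spaces has the maximal approximation by affine property (maximal AAP) if for every $\varepsilon>0$, every Lipschitz map $f\in \mathrm{Lip}(X,Y)$ and every ball $B\subseteq X$, there exist a ball $B_1\subseteq B$ and an affine function $g:B_1\to Y$ such that $$\mathrm{Lip}(g) > \mathrm{Lip}(f|_B)-\varepsilon \quad\text{and}\quad \sup_{x\in B_1}\|g(x)-f(x)\| \le \varepsilon\,\mathrm{diam}(B_1)\,\mathrm{Lip}(f).$$ *)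

theory Defs
  imports "HOL-Analysis.Analysis"
begin

(* The supremum is taken in ereal, so that it is infinite when f is not Lipschitz on A.
   Inserting 0 only matters when A has at most one point: the Lipschitz number is then 0
   (the supremum of the empty set in [0, infinity]) rather than minus infinity. *)
definition Lip_number :: "('a::real_normed_vector \<Rightarrow> 'b::real_normed_vector) \<Rightarrow> 'a set \<Rightarrow> ereal" where
  "Lip_number f A =
     Sup (insert 0 {ereal (norm (f p - f q) / norm (p - q)) | p q. p \<in> A \<and> q \<in> A \<and> p \<noteq> q})"

definition Lip_maps :: "('a::real_normed_vector \<Rightarrow> 'b::real_normed_vector) set" where
  "Lip_maps = {f. \<exists>L. L-lipschitz_on UNIV f}"

(* Balls are closed and nondegenerate. Using open balls throughout gives the same property below:
   inclusions between balls and the two suprema do not change on passing to closures. *)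
definition is_ball :: "'a::real_normed_vector set \<Rightarrow> bool" where
  "is_ball B \<longleftrightarrow> (\<exists>x r. r > 0 \<and> B = cball x r)"

(* Affine functions defined on a convex set S; the values of g outside S are irrelevant. *)
definition affine_fun_on :: "'a::real_vector set \<Rightarrow> ('a \<Rightarrow> 'b::real_vector) \<Rightarrow> bool" where
  "affine_fun_on S g \<longleftrightarrow>
     (\<forall>x\<in>S. \<forall>y\<in>S. \<forall>t\<in>{0..1}.
        g ((1 - t) *\<^sub>R x + t *\<^sub>R y) = (1 - t) *\<^sub>R g x + t *\<^sub>R g y)"

definition maximal_AAP :: "'a::banach itself \<Rightarrow> 'b::banach itself \<Rightarrow> bool" where
  "maximal_AAP X Y \<longleftrightarrow>
     (\<forall>\<epsilon>::real. \<epsilon> > 0 \<longrightarrow>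
       (\<forall>f \<in> (Lip_maps :: ('a \<Rightarrow> 'b) set). \<forall>B. is_ball B \<longrightarrow>
         (\<exists>B\<^sub>1 g. is_ball B\<^sub>1 \<and> B\<^sub>1 \<subseteq> B \<and> affine_fun_on B\<^sub>1 g \<and>
            Lip_number g B\<^sub>1 > Lip_number f B - ereal \<epsilon> \<and>
            (SUP x\<in>B\<^sub>1. ereal (norm (g x - f x)))
              \<le> ereal \<epsilon> * ereal (diameter B\<^sub>1) * Lip_number f UNIV)))"

end

theory Submission
  imports Defs
begin

text \<open>Choose \<open>p < q\<close> in \<open>B\<close> whose chord has slope \<open>s\<close> with \<open>\<bar>s\<bar>\<close> within \<open>\<eta>\<close> of
  \<open>L = Lip(f|\<^sub>B)\<close>. A function that is \<open>L\<close>-Lipschitz and nearly attains the maximal growth over all of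
  \<open>[p, q]\<close> cannot leave the chord by more than \<open>(L - \<bar>s\<bar>)(q - p)\<close>: the Lipschitz bound from \<open>p\<close>
  controls one side and the one from \<open>q\<close> the other. So \<open>B\<^sub>1 = [p, q]\<close> and the chord itself work.\<close>

lemma Lip_number_nonneg: "0 \<le> Lip_number f A"
  unfolding Lip_number_def by (rule Sup_upper) simp

lemma Lip_number_upper:
  assumes "p \<in> A" "q \<in> A" "p \<noteq> q"
  shows "ereal (norm (f p - f q) / norm (p - q)) \<le> Lip_number f A"
  unfolding Lip_number_def using assms by (intro Sup_upper) blast

lemma Lip_number_mono: "A \<subseteq> B \<Longrightarrow> Lip_number f A \<le> Lip_number f B"
  unfolding Lip_number_def by (rule Sup_subset_mono) blast

lemma Lip_number_le_lipschitz:
  assumes "K-lipschitz_on A f"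
  shows "Lip_number f A \<le> ereal K"
  unfolding Lip_number_def
proof (rule Sup_least)
  fix z assume z: "z \<in> insert 0 {ereal (norm (f p - f q) / norm (p - q)) |p q. p \<in> A \<and> q \<in> A \<and> p \<noteq> q}"
  show "z \<le> ereal K"
  proof (cases "z = 0")
    case True
    then show ?thesis using lipschitz_on_nonneg[OF assms] by simp
  next
    case False
    with z obtain p q where "p \<in> A" "q \<in> A" "p \<noteq> q" "z = ereal (norm (f p - f q) / norm (p - q))"
      by blast
    then show ?thesis
      using lipschitz_onD[OF assms, of p q] by (simp add: dist_norm divide_le_eq)
  qed
qed

lemma Lip_number_bound:
  assumes "Lip_number f A = ereal L" "p \<in> A" "q \<in> A"
  shows "norm (f p - f q) \<le> L * norm (p - q)"
proof (cases "p = q")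
  case False
  then show ?thesis
    using Lip_number_upper[of p A q f] assms by (simp add: divide_le_eq)
qed simp

lemma chord_error:
  fixes f :: "real \<Rightarrow> real"
  assumes lip: "\<And>x y. \<lbrakk>x \<in> {p..q}; y \<in> {p..q}\<rbrakk> \<Longrightarrow> \<bar>f x - f y\<bar> \<le> L * \<bar>x - y\<bar>"
    and s: "f q - f p = s * (q - p)" and pq: "p < q" and x: "x \<in> {p..q}"
  shows "\<bar>f p + s * (x - p) - f x\<bar> \<le> (L - \<bar>s\<bar>) * (q - p)"
proof -
  have "\<bar>s\<bar> * (q - p) \<le> L * (q - p)"
    using lip[of q p] s pq by (simp add: abs_mult)
  \<comment> \<open>With \<open>L - \<bar>s\<bar>\<close> nonnegative, an error proportional to the
    distance from either endpoint can be enlarged to one proportional to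
    \<open>q - p\<close>.\<close>
  then have sL: "\<bar>s\<bar> \<le> L" using pq by simp
  have 1: "(L - \<bar>s\<bar>) * (x - p) \<le> (L - \<bar>s\<bar>) * (q - p)"
    and 2: "(L - \<bar>s\<bar>) * (q - x) \<le> (L - \<bar>s\<bar>) * (q - p)"
    using sL x by (auto intro!: mult_left_mono)
  have 3: "\<bar>f x - f p\<bar> \<le> L * (x - p)" and 4: "\<bar>f q - f x\<bar> \<le> L * (q - x)"
    using lip[of x p] lip[of q x] x pq by auto
  \<comment> \<open>The chord rewritten from its right endpoint, so that the estimate
    \<open>4\<close> can be compared with it.\<close>
  have *: "f p + s * (x - p) = f q - s * (q - x)"
    using s by (simp add: algebra_simps)
  \<comment> \<open>For \<open>s \<ge> 0\<close> the bound from \<open>p\<close> limits how far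
    \<open>f\<close> rises above the chord, and the bound from \<open>q\<close> how far it falls
    below. For \<open>s < 0\<close> the endpoints swap roles.\<close>
  show ?thesis
  proof (cases "0 \<le> s")
    case True
    then have "f x - (f p + s * (x - p)) \<le> (L - \<bar>s\<bar>) * (x - p)"
      "f q - s * (q - x) - f x \<le> (L - \<bar>s\<bar>) * (q - x)"
      using 3 4 by (auto simp: left_diff_distrib)
    then show ?thesis using 1 2 * by linarith
  next
    case False
    then have "f p + s * (x - p) - f x \<le> (L - \<bar>s\<bar>) * (x - p)"
      "f x - (f q - s * (q - x)) \<le> (L - \<bar>s\<bar>) * (q - x)"
      using 3 4 by (auto simp: algebra_simps)
    then show ?thesis using 1 2 * by linarith
  qed
qed

text \<open>Special to dimension one: the segment carrying the chord is itself a ball, so it can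
  serve as \<open>B\<^sub>1\<close>.\<close>

lemma is_ball_real_interval: "p < q \<Longrightarrow> is_ball {p..q::real}"
  unfolding is_ball_def
  by (rule exI[of _ "(p + q) / 2"], rule exI[of _ "(q - p) / 2"]) (auto simp: cball_eq_atLeastAtMost field_simps)

lemma AAP_real_step:
  fixes f :: "real \<Rightarrow> real"
  assumes e: "\<epsilon> > 0" and f: "f \<in> Lip_maps" and B: "is_ball B"
  shows "\<exists>B\<^sub>1 g. is_ball B\<^sub>1 \<and> B\<^sub>1 \<subseteq> B \<and> affine_fun_on B\<^sub>1 g \<and>
            Lip_number g B\<^sub>1 > Lip_number f B - ereal \<epsilon> \<and>
            (SUP x\<in>B\<^sub>1. ereal (norm (g x - f x)))
              \<le> ereal \<epsilon> * ereal (diameter B\<^sub>1) * Lip_number f UNIV"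
proof -
  obtain K where K: "K-lipschitz_on UNIV f"
    using f unfolding Lip_maps_def by blast
  \<comment> \<open>Finiteness of the Lipschitz number allows passing from \<open>ereal\<close> to
    real arithmetic.\<close>
  obtain M where M: "Lip_number f UNIV = ereal M"
    using Lip_number_le_lipschitz[OF K] Lip_number_nonneg[of f UNIV]
    by (cases "Lip_number f UNIV") auto
  have BM: "Lip_number f B \<le> ereal M"
    using Lip_number_mono[of B UNIV f] M by simp
  then obtain L where L: "Lip_number f B = ereal L"
    using Lip_number_nonneg[of f B] by (cases "Lip_number f B") auto
  have "0 \<le> L" "L \<le> M" using BM L Lip_number_nonneg[of f B] by auto
  show ?thesis
  proof (cases "L = 0")
    \<comment> \<open>Here \<open>f\<close> is constant on \<open>B\<close>, so \<open>B\<close> and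
      \<open>f\<close> themselves serve as the witnesses; the \<open>\<eta>\<close> of the other
      case would be zero.\<close>
    case True
    then have const: "f x = f y" if "x \<in> B" "y \<in> B" for x y
      using Lip_number_bound[OF L that] by simp
    have "convex B" using B unfolding is_ball_def by auto
    then have aff: "affine_fun_on B f"
      unfolding affine_fun_on_def
    proof (intro ballI)
      fix x y t :: real assume "x \<in> B" "y \<in> B" "t \<in> {0..1}"
      then have "(1 - t) *\<^sub>R x + t *\<^sub>R y \<in> B"
        using \<open>convex B\<close> by (intro convexD) auto
      then have "f ((1 - t) *\<^sub>R x + t *\<^sub>R y) = f x" "f y = f x"
        using const \<open>x \<in> B\<close> \<open>y \<in> B\<close> by blast+
      then show "f ((1 - t) *\<^sub>R x + t *\<^sub>R y) = (1 - t) *\<^sub>R f x + t *\<^sub>R f y"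
        by (simp add: algebra_simps)
    qed
    have "bounded B" using B unfolding is_ball_def by auto
    then have "0 \<le> \<epsilon> * diameter B * M"
      using e \<open>0 \<le> L\<close> \<open>L \<le> M\<close> by (simp add: diameter_ge_0)
    then have "(SUP x\<in>B. ereal (norm (f x - f x))) \<le> ereal \<epsilon> * ereal (diameter B) * Lip_number f UNIV"
      unfolding M by (intro SUP_least) simp
    moreover have "Lip_number f B > Lip_number f B - ereal \<epsilon>"
      using L e by simp
    ultimately show ?thesis using B aff by blast
  next
    case False
    then have Lpos: "0 < L" using \<open>0 \<le> L\<close> by simp
    \<comment> \<open>The bound \<open>L\<close> keeps \<open>L - \<eta>\<close> nonnegative,
      \<open>\<epsilon>\<close> serves the slope condition, and \<open>\<epsilon> * M\<close> the
      error condition. Positivity uses \<open>0 < L \<le> M\<close>.\<close>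
    define \<eta> where "\<eta> = min L (min \<epsilon> (\<epsilon> * M))"
    have \<eta>: "0 < \<eta>" "\<eta> \<le> L" "\<eta> \<le> \<epsilon>" "\<eta> \<le> \<epsilon> * M"
      unfolding \<eta>_def using Lpos e \<open>L \<le> M\<close> by auto
    have "ereal (L - \<eta>) < Lip_number f B" using L \<eta> by simp
    then obtain z where z: "ereal (L - \<eta>) < z"
      "z \<in> insert 0 {ereal (norm (f p - f q) / norm (p - q)) |p q. p \<in> B \<and> q \<in> B \<and> p \<noteq> q}"
      unfolding Lip_number_def less_Sup_iff by blast
    \<comment> \<open>This rules out the inserted default \<open>0\<close>, so \<open>z\<close> is a
      genuine difference quotient.\<close>
    have "z \<noteq> 0" using z(1) \<eta>(2) by auto
    with z obtain p' q' where "p' \<in> B" "q' \<in> B" "p' \<noteq> q'"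
      "L - \<eta> < norm (f p' - f q') / norm (p' - q')"
      by auto
    then obtain p q where pq: "p \<in> B" "q \<in> B" "p < q" "L - \<eta> < norm (f q - f p) / norm (q - p)"
      by (metis linorder_neqE norm_minus_commute)
    define s where "s = (f q - f p) / (q - p)"
    define g where "g x = f p + s * (x - p)" for x
    have s: "f q - f p = s * (q - p)" unfolding s_def using pq by simp
    have sL: "L - \<eta> < \<bar>s\<bar>" using pq(4) by (simp add: s_def)
    have "convex B" using B unfolding is_ball_def by auto
    then have sub: "{p..q} \<subseteq> B"
      using pq by (metis closed_segment_eq_real_ivl closed_segment_subset less_imp_le)
    have aff: "affine_fun_on {p..q} g"
      unfolding affine_fun_on_def g_def by (auto simp: algebra_simps)
    have "g p - g q = s * (p - q)" by (simp add: g_def algebra_simps)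
    \<comment> \<open>Only a lower bound for the Lipschitz number of \<open>g\<close> is required,
      so the quotient at the two endpoints suffices.\<close>
    then have "norm (g p - g q) / norm (p - q) = \<bar>s\<bar>"
      using pq by (simp add: abs_mult)
    then have "ereal \<bar>s\<bar> \<le> Lip_number g {p..q}"
      using Lip_number_upper[of p "{p..q}" q g] pq by simp
    moreover have "Lip_number f B - ereal \<epsilon> < ereal \<bar>s\<bar>"
      using L sL \<eta> by simp
    ultimately have lip: "Lip_number f B - ereal \<epsilon> < Lip_number g {p..q}"
      by (rule less_le_trans[rotated])
    have diam: "diameter {p..q} = q - p"
      using pq(3) by (simp add: diameter_closed_interval)
    have err: "norm (g x - f x) \<le> \<epsilon> * (q - p) * M" if x: "x \<in> {p..q}" for x
    proof -
      have "norm (g x - f x) \<le> (L - \<bar>s\<bar>) * (q - p)"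
        unfolding g_def real_norm_def
        using Lip_number_bound[OF L] sub by (intro chord_error[OF _ s pq(3) x]) (auto simp: subset_iff)
      \<comment> \<open>By the choice of the chord,
        \<open>L - \<bar>s\<bar> < \<eta> \<le> \<epsilon> * M\<close>.\<close>
      also have "\<dots> \<le> (\<epsilon> * M) * (q - p)"
        using sL \<eta> pq(3) by (intro mult_right_mono) auto
      finally show ?thesis by (simp add: ac_simps)
    qed
    have "(SUP x\<in>{p..q}. ereal (norm (g x - f x)))
        \<le> ereal \<epsilon> * ereal (diameter {p..q}) * Lip_number f UNIV"
      unfolding M diam by (rule SUP_least) (simp add: err[simplified])
    then show ?thesis
      using is_ball_real_interval[OF pq(3)] sub aff lip by blast
  qed
qed

theorem theorem3p2:
  shows "maximal_AAP TYPE(real) TYPE(real)"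
  unfolding maximal_AAP_def using AAP_real_step by blast

end
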